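(* Let $\mathcal V_{W\dot W}$ be a genaut and $\mathcal V_W$ a linear subspace of vectors on $W$. Then $\mathcal V_W$ is conditioned invariant in $\mathcal V_{W\dot W}$ if and only if $\mathcal V^\perp_{W'}$ is controlled invariant in $\mathcal V^a_{W'\dot W'}$; and $\mathcal V_W$ is controlled invariant in $\mathcal V_{W\dot W}$ if and only if $\mathcal V^\perp_{W'}$ is conditioned invariant in $\mathcal V^a_{W'\dot W'}$.
   Context: Fix a field $\mathbb F$; all index sets are finite. A vector on $X$ is a function $X\to\mathbb F$. $W,\dot W$ are disjoint sets that are copies of each other (in bijection); $(\mathcal V_W)_{\dot W}$ denotes $\mathcal V_W$ transported along the bijection. A genaut $\mathcal V_{W\dot W}$ is a linear subspace of vectors $(f_W,g_{\dot W})$ on $W\uplus\dot W$. Matched composition: $\mathcal V_{XY}\leftrightarrow\mathcal V_Y:=\{f_X:\exists g_Y\in\mathcal V_Y,\ (f_X,g_Y)\in\mathcal V_{XY}\}$. $\mathcal V^\perp$ is the orthogonal complement with respect to the dot product $\sum_e f(e)g(e)$. $\mathcal V_W$ is conditioned invariant in $\mathcal V_{W\dot W}$ iff $\mathcal V_{W\dot W}\leftrightarrow\mathcal V_W\subseteq(\mathcal V_W)_{\dot W}$, and controlled invariant iff $\mathcal V_{W\dot W}\leftrightarrow(\mathcal V_W)_{\dot W}\supseteq\mathcal V_W$. Adjoint: $W',\dot W'$ are disjoint copies of $W$ and $\mathcal V^a_{W'\dot W'}:=(\mathcal V_{W\dot W}^\perp)_{-\dot W'W'}$, i.e. each $(f_W,g_{\dot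 W})\in\mathcal V_{W\dot W}^\perp$ becomes the vector with $W'$-component $g$ and $\dot W'$-component $-f$. $\mathcal V^\perp_{W'}:=(\mathcal V_W^\perp)_{W'}$ is the copy of $\mathcal V_W^\perp$ on $W'$. *)

theory Defs
  imports Complex_Main "HOL-Library.Function_Algebras"
begin

(* A vector X -> F on a subset X of the ambient type is represented by its extension by zero
   outside X.  For disjoint X and Y the vector (f_X, g_Y) on the disjoint union of X and Y
   is then the pointwise sum f + g. *)

definition vscale :: "'f::field \<Rightarrow> ('e \<Rightarrow> 'f) \<Rightarrow> ('e \<Rightarrow> 'f)" where
  "vscale c f = (\<lambda>e. c * f e)"

interpretation fvec: vector_space "vscale :: 'f::field \<Rightarrow> ('e \<Rightarrow> 'f) \<Rightarrow> ('e \<Rightarrow> 'f)"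
  by unfold_locales (auto simp: vscale_def fun_eq_iff algebra_simps)

definition vectors_on :: "'e set \<Rightarrow> ('e \<Rightarrow> 'f::field) set" where
  "vectors_on X = {f. \<forall>e. e \<notin> X \<longrightarrow> f e = 0}"

definition vspace_on :: "'e set \<Rightarrow> ('e \<Rightarrow> 'f::field) set \<Rightarrow> bool" where
  "vspace_on X V \<longleftrightarrow> fvec.subspace V \<and> V \<subseteq> vectors_on X"

definition orth_compl :: "'e set \<Rightarrow> ('e \<Rightarrow> 'f::field) set \<Rightarrow> ('e \<Rightarrow> 'f) set" where
  "orth_compl X V = {f \<in> vectors_on X. \<forall>g\<in>V. (\<Sum>e\<in>X. f e * g e) = 0}"

(* V_XY <-> V_Y, for disjoint X and Y, a space V_XY on their union and a space V_Y on Y;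
   the result is a space on X. *)
definition matched_comp ::
    "'e set \<Rightarrow> ('e \<Rightarrow> 'f::field) set \<Rightarrow> ('e \<Rightarrow> 'f) set \<Rightarrow> ('e \<Rightarrow> 'f) set" where
  "matched_comp X VXY VY = {f \<in> vectors_on X. \<exists>g\<in>VY. f + g \<in> VXY}"

(* The copy on Y of a vector f on X, along a bijection \<phi> from X onto Y. *)
definition transport :: "'e set \<Rightarrow> 'e set \<Rightarrow> ('e \<Rightarrow> 'e) \<Rightarrow> ('e \<Rightarrow> 'f::field) \<Rightarrow> ('e \<Rightarrow> 'f)" where
  "transport X Y \<phi> f = (\<lambda>y. if y \<in> Y then f (inv_into X \<phi> y) else 0)"

definition genaut :: "'e set \<Rightarrow> 'e set \<Rightarrow> ('e \<Rightarrow> 'e) \<Rightarrow> ('e \<Rightarrow> 'f::field) set \<Rightarrow> bool" where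
  "genaut W Wd d V \<longleftrightarrow>
     finite W \<and> W \<inter> Wd = {} \<and> bij_betw d W Wd \<and> vspace_on (W \<union> Wd) V"

definition conditioned_invariant ::
    "'e set \<Rightarrow> 'e set \<Rightarrow> ('e \<Rightarrow> 'e) \<Rightarrow> ('e \<Rightarrow> 'f::field) set \<Rightarrow> ('e \<Rightarrow> 'f) set \<Rightarrow> bool" where
  "conditioned_invariant W Wd d V VW \<longleftrightarrow>
     matched_comp Wd V VW \<subseteq> transport W Wd d ` VW"

definition controlled_invariant ::
    "'e set \<Rightarrow> 'e set \<Rightarrow> ('e \<Rightarrow> 'e) \<Rightarrow> ('e \<Rightarrow> 'f::field) set \<Rightarrow> ('e \<Rightarrow> 'f) set \<Rightarrow> bool" where
  "controlled_invariant W Wd d V VW \<longleftrightarrow>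
     VW \<subseteq> matched_comp W V (transport W Wd d ` VW)"

(* d identifies W with its dotted copy Wd, p identifies W with W', and d' identifies W' with
   its dotted copy Wd'.  Each (f_W, g_Wd) in the complement of V yields the vector with
   W'-component g and Wd'-component -f. *)
definition adjoint ::
    "'e set \<Rightarrow> 'e set \<Rightarrow> ('e \<Rightarrow> 'e) \<Rightarrow> 'e set \<Rightarrow> 'e set \<Rightarrow> ('e \<Rightarrow> 'e) \<Rightarrow> ('e \<Rightarrow> 'e)
      \<Rightarrow> ('e \<Rightarrow> 'f::field) set \<Rightarrow> ('e \<Rightarrow> 'f) set" where
  "adjoint W Wd d W' Wd' d' p V =
     {transport Wd W' (p \<circ> inv_into W d) g + (- transport W Wd' (d' \<circ> p) f) | f g.
        f \<in> vectors_on W \<and> g \<in> vectors_on Wd \<and> f + g \<in> orth_compl (W \<union> Wd) V}"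

end

theory Submission
  imports Defs
begin

text \<open>
  Write \<open>S\<close> for the space on \<open>W\<close>, \<open>T\<close> for the transport from \<open>W\<close> to its dotted copy, and \<open>V\<close>
  for the genaut. In terms of pairs of vectors on \<open>W\<close>, controlled invariance says that \<open>S\<close> is
  contained in \<open>V + T S\<close>, and conditioned invariance says that every \<open>f + T g\<close> in \<open>V\<close> with
  \<open>f \<in> S\<close> has \<open>g \<in> S\<close>.

  Orthogonal complementation exchanges these two kinds of condition. For subspaces \<open>A\<close>, \<open>B\<close>, \<open>C\<close>
  of the vectors on a finite set, \<open>C \<subseteq> A + B\<close> holds iff \<open>A\<^sup>\<bottom> \<inter> B\<^sup>\<bottom> \<subseteq> C\<^sup>\<bottom>\<close>
  (lemma \<open>contained_in_sum_iff_orth_compl\<close>). Inside the vectors on the union of \<open>W\<close> and its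
  dotted copy, \<open>f + T g\<close> is orthogonal to \<open>S\<close> iff \<open>f\<close> is, and orthogonal to \<open>T S\<close> iff \<open>g\<close> is.
  Taking \<open>C = S\<close>, \<open>A = V\<close>, \<open>B = T S\<close> turns controlled invariance of \<open>S\<close> into: whenever
  \<open>f + T g \<in> V\<^sup>\<bottom>\<close> and \<open>g \<in> S\<^sup>\<bottom>\<close>, also \<open>f \<in> S\<^sup>\<bottom>\<close>. Up to a sign, which a subspace ignores, this is
  conditioned invariance of \<open>S\<^sup>\<bottom>\<close> in the adjoint, where the roles of \<open>f\<close> and \<open>g\<close> are swapped.
  Taking \<open>C = T S\<^sup>\<bottom>\<close>, \<open>A = V\<^sup>\<bottom>\<close>, \<open>B = S\<^sup>\<bottom>\<close> gives the other equivalence in the same way.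

  The one fact of linear algebra behind this is \<open>S\<^sup>\<bottom>\<^sup>\<bottom> = S\<close>. The dot product over a general field
  may have isotropic vectors, so a subspace may meet its complement; the proof separates a vector
  from a subspace by a linear functional instead of splitting the space.
\<close>

section \<open>Orthogonal complements\<close>

lemma vectors_on_add: "f \<in> vectors_on X \<Longrightarrow> g \<in> vectors_on X \<Longrightarrow> f + g \<in> vectors_on X"
  by (auto simp: vectors_on_def)

lemma vectors_on_uminus: "- f \<in> vectors_on X \<longleftrightarrow> f \<in> vectors_on X"
  by (auto simp: vectors_on_def)

lemma vectors_on_mono: "f \<in> vectors_on X \<Longrightarrow> X \<subseteq> Y \<Longrightarrow> f \<in> vectors_on Y"
  by (auto simp: vectors_on_def)

lemma subspace_uminus: "fvec.subspace S \<Longrightarrow> - f \<in> S \<longleftrightarrow> f \<in> S"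
  using fvec.subspace_neg by force

lemma orth_compl_subset: "orth_compl X V \<subseteq> vectors_on X"
  by (auto simp: orth_compl_def)

lemma subspace_orth_compl:
  fixes V :: "('e \<Rightarrow> 'f::field) set"
  shows "fvec.subspace (orth_compl X V)"
proof (rule fvec.subspaceI)
  fix f g assume "f \<in> orth_compl X V" "g \<in> orth_compl X V"
  then show "f + g \<in> orth_compl X V"
    by (simp add: orth_compl_def vectors_on_add distrib_right sum.distrib)
next
  fix c f assume f: "f \<in> orth_compl X V"
  have "(\<Sum>e\<in>X. vscale c f e * h e) = c * (\<Sum>e\<in>X. f e * h e)" for h
    by (simp add: vscale_def sum_distrib_left mult.assoc)
  moreover have "vscale c f \<in> vectors_on X"
    using f by (simp add: orth_compl_def vectors_on_def vscale_def)
  ultimately show "vscale c f \<in> orth_compl X V"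
    using f by (simp add: orth_compl_def)
qed (simp add: orth_compl_def vectors_on_def)

text \<open>A linear functional on the vectors on a finite set is the dot product with the vector of its
  values at the unit vectors. It therefore suffices to extend the functional that vanishes on a
  basis of \<open>V\<close> and takes the value \<open>1\<close> at \<open>f\<close>.\<close>

lemma separating_vector:
  fixes V :: "('e \<Rightarrow> 'f::field) set"
  assumes X: "finite X" and V: "fvec.subspace V" "V \<subseteq> vectors_on X"
    and f: "f \<in> vectors_on X" "f \<notin> V"
  shows "\<exists>h\<in>orth_compl X V. (\<Sum>e\<in>X. h e * f e) \<noteq> 0"
proof -
  interpret functional: vector_space_pair
    "vscale :: 'f \<Rightarrow> ('e \<Rightarrow> 'f) \<Rightarrow> ('e \<Rightarrow> 'f)" "(*) :: 'f \<Rightarrow> 'f \<Rightarrow> 'f"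
    by unfold_locales (auto simp: algebra_simps)
  obtain B where B: "B \<subseteq> V" "fvec.independent B" "fvec.span B = V"
    using fvec.basis_exists V(1) by (metis fvec.span_minimal subset_antisym)
  have indep: "fvec.independent (insert f B)"
    using B f(2) by (auto simp: fvec.independent_insert)
  obtain \<phi> :: "('e \<Rightarrow> 'f) \<Rightarrow> 'f" where lin: "Vector_Spaces.linear vscale (*) \<phi>"
    and \<phi>: "\<forall>x\<in>insert f B. \<phi> x = (if x = f then 1 else 0)"
    using functional.linear_independent_extend[OF indep, of "\<lambda>x. if x = f then 1 else 0"] by blast
  have \<phi>f: "\<phi> f = 1" using \<phi> by simp
  have \<phi>B: "\<phi> x = 0" if "x \<in> B" for x using \<phi> that B f(2) by auto
  have \<phi>V: "\<phi> x = 0" if "x \<in> V" for x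
    using functional.linear_eq_0_on_span[OF lin] \<phi>B that B(3) by blast
  define u :: "'e \<Rightarrow> 'e \<Rightarrow> 'f" where "u = (\<lambda>e x. if x = e then 1 else 0)"
  define h where "h = (\<lambda>e. if e \<in> X then \<phi> (u e) else 0)"
  have rep: "(\<Sum>e\<in>X. h e * g e) = \<phi> g" if "g \<in> vectors_on X" for g
  proof -
    have "(\<Sum>e\<in>X. vscale (g e) (u e)) x = g x" for x
    proof -
      have "(\<Sum>e\<in>X. vscale (g e) (u e)) x = (\<Sum>e\<in>X. vscale (g e) (u e) x)"
        by (induction X rule: infinite_finite_induct) auto
      also have "\<dots> = (\<Sum>e\<in>X. if e = x then g e else 0)"
        by (rule sum.cong) (auto simp: vscale_def u_def)
      also have "\<dots> = g x" using X that by (auto simp: vectors_on_def)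
      finally show ?thesis .
    qed
    then have "\<phi> g = \<phi> (\<Sum>e\<in>X. vscale (g e) (u e))" by (metis ext)
    also have "\<dots> = (\<Sum>e\<in>X. g e * \<phi> (u e))"
      by (simp add: functional.linear_sum[OF lin] functional.linear_scale[OF lin])
    also have "\<dots> = (\<Sum>e\<in>X. h e * g e)" by (rule sum.cong) (auto simp: h_def mult.commute)
    finally show ?thesis by simp
  qed
  have "h \<in> orth_compl X V"
    using rep \<phi>V V(2) by (auto simp: orth_compl_def vectors_on_def h_def subset_iff)
  then show ?thesis using rep[OF f(1)] \<phi>f by (intro bexI[of _ h]) auto
qed

lemma orth_compl_orth_compl:
  fixes V :: "('e \<Rightarrow> 'f::field) set"
  assumes X: "finite X" and V: "fvec.subspace V" "V \<subseteq> vectors_on X"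
  shows "orth_compl X (orth_compl X V) = V"
proof
  show "V \<subseteq> orth_compl X (orth_compl X V)"
    using V(2) by (auto simp: orth_compl_def mult.commute)
  show "orth_compl X (orth_compl X V) \<subseteq> V"
  proof
    fix f assume f: "f \<in> orth_compl X (orth_compl X V)"
    then have *: "\<forall>h\<in>orth_compl X V. (\<Sum>e\<in>X. h e * f e) = 0"
      by (auto simp: orth_compl_def mult.commute)
    then show "f \<in> V" using separating_vector[OF X V] f orth_compl_subset by blast
  qed
qed

text \<open>Both sides say \<open>C \<subseteq> A + B\<close>: the left side is this inclusion because \<open>B\<close> is closed under
  negation, and the right side is \<open>(A + B)\<^sup>\<bottom> \<subseteq> C\<^sup>\<bottom>\<close>, which double complementation reverses.\<close>

lemma contained_in_sum_iff_orth_compl: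
  fixes A B C :: "('e \<Rightarrow> 'f::field) set"
  assumes X: "finite X" and A: "fvec.subspace A" "A \<subseteq> vectors_on X"
    and B: "fvec.subspace B" "B \<subseteq> vectors_on X" and C: "C \<subseteq> vectors_on X"
  shows "(\<forall>c\<in>C. \<exists>b\<in>B. c + b \<in> A) \<longleftrightarrow>
    (\<forall>h\<in>orth_compl X A. h \<in> orth_compl X B \<longrightarrow> h \<in> orth_compl X C)"
    (is "?L \<longleftrightarrow> ?R")
proof -
  define D where "D = {a + b | a b. a \<in> A \<and> b \<in> B}"
  have D: "fvec.subspace D" "D \<subseteq> vectors_on X"
    using fvec.subspace_sums[OF A(1) B(1)] A B by (auto simp: D_def intro: vectors_on_add)
  have perp: "orth_compl X D = orth_compl X A \<inter> orth_compl X B"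
  proof
    have "a \<in> D" if "a \<in> A" for a
      using that fvec.subspace_0[OF B(1)] unfolding D_def
      by (metis (mono_tags, lifting) add.right_neutral mem_Collect_eq)
    moreover have "b \<in> D" if "b \<in> B" for b
      using that fvec.subspace_0[OF A(1)] unfolding D_def
      by (metis (mono_tags, lifting) add.left_neutral mem_Collect_eq)
    ultimately show "orth_compl X D \<subseteq> orth_compl X A \<inter> orth_compl X B"
      by (auto simp: orth_compl_def)
    show "orth_compl X A \<inter> orth_compl X B \<subseteq> orth_compl X D"
      by (auto simp: orth_compl_def D_def distrib_left sum.distrib)
  qed
  have "(\<exists>b\<in>B. c + b \<in> A) \<longleftrightarrow> c \<in> D" for c
  proof
    assume "\<exists>b\<in>B. c + b \<in> A"
    then obtain b where "b \<in> B" "c + b \<in> A" by blast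
    moreover have "c = (c + b) + (- b)" by simp
    ultimately show "c \<in> D" using subspace_uminus[OF B(1)] unfolding D_def by blast
  next
    assume "c \<in> D"
    then obtain a b where "a \<in> A" "b \<in> B" "c = a + b" unfolding D_def by blast
    moreover from this have "c + (- b) \<in> A" by simp
    ultimately show "\<exists>b\<in>B. c + b \<in> A" using subspace_uminus[OF B(1)] by blast
  qed
  then have L: "?L \<longleftrightarrow> C \<subseteq> D" by blast
  have "C \<subseteq> D \<longleftrightarrow> orth_compl X D \<subseteq> orth_compl X C"
  proof
    show "C \<subseteq> D \<Longrightarrow> orth_compl X D \<subseteq> orth_compl X C"
      by (auto simp: orth_compl_def)
    assume "orth_compl X D \<subseteq> orth_compl X C"
    then have "orth_compl X (orth_compl X C) \<subseteq> orth_compl X (orth_compl X D)"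
      by (auto simp: orth_compl_def)
    moreover have "C \<subseteq> orth_compl X (orth_compl X C)"
      using C by (auto simp: orth_compl_def mult.commute)
    ultimately show "C \<subseteq> D" using orth_compl_orth_compl[OF X D] by blast
  qed
  then show ?thesis using L perp by blast
qed

section \<open>Transport along a bijection\<close>

lemma transport_in_vectors_on: "transport X Y \<phi> f \<in> vectors_on Y"
  by (auto simp: transport_def vectors_on_def)

lemma transport_apply: "bij_betw \<phi> X Y \<Longrightarrow> x \<in> X \<Longrightarrow> transport X Y \<phi> f (\<phi> x) = f x"
  by (auto simp: transport_def bij_betw_def)

lemma transport_unique:
  assumes "bij_betw \<phi> X Y" "h \<in> vectors_on Y" "\<And>x. x \<in> X \<Longrightarrow> h (\<phi> x) = f x"
  shows "transport X Y \<phi> f = h"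
proof
  fix y
  show "transport X Y \<phi> f y = h y"
  proof (cases "y \<in> Y")
    case True
    then obtain x where "x \<in> X" "y = \<phi> x" using assms(1) by (auto simp: bij_betw_def)
    then show ?thesis using assms by (simp add: transport_apply)
  next
    case False
    then show ?thesis using assms(2) by (simp add: transport_def vectors_on_def)
  qed
qed

lemma transport_add: "transport X Y \<phi> (f + g) = transport X Y \<phi> f + transport X Y \<phi> g"
  by (auto simp: transport_def fun_eq_iff)

lemma transport_uminus: "transport X Y \<phi> (- f) = - transport X Y \<phi> f"
  by (auto simp: transport_def fun_eq_iff)

lemma transport_vscale: "transport X Y \<phi> (vscale c f) = vscale c (transport X Y \<phi> f)"
  by (auto simp: transport_def vscale_def fun_eq_iff)

lemma subspace_transport:
  fixes S :: "('e \<Rightarrow> 'f::field) set"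
  assumes "fvec.subspace S"
  shows "fvec.subspace (transport X Y \<phi> ` S)"
proof -
  have "(0 :: 'e \<Rightarrow> 'f) = transport X Y \<phi> 0" by (auto simp: transport_def fun_eq_iff)
  then show ?thesis
    using assms unfolding fvec.subspace_def
    by (auto simp flip: transport_add transport_vscale)
qed

lemma transport_image_vectors_on:
  assumes "bij_betw \<phi> X Y"
  shows "transport X Y \<phi> ` vectors_on X = (vectors_on Y :: ('e \<Rightarrow> 'f::field) set)"
    (is "?L = ?R")
proof
  show "?R \<subseteq> ?L"
  proof
    fix h :: "'e \<Rightarrow> 'f" assume h: "h \<in> vectors_on Y"
    define g where "g = (\<lambda>x. if x \<in> X then h (\<phi> x) else 0)"
    have "transport X Y \<phi> g = h"
      using assms h by (intro transport_unique) (auto simp: g_def)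
    moreover have "g \<in> vectors_on X" by (simp add: vectors_on_def g_def)
    ultimately show "h \<in> ?L" by blast
  qed
qed (auto simp: transport_in_vectors_on)

lemma transport_eq_iff:
  assumes "bij_betw \<phi> X Y" "f \<in> vectors_on X" "g \<in> vectors_on X"
  shows "transport X Y \<phi> f = transport X Y \<phi> g \<longleftrightarrow> f = g"
proof
  assume eq: "transport X Y \<phi> f = transport X Y \<phi> g"
  have "f x = g x" for x
  proof (cases "x \<in> X")
    case True
    then show ?thesis using eq transport_apply[OF assms(1)] by metis
  next
    case False
    then show ?thesis using assms by (simp add: vectors_on_def)
  qed
  then show "f = g" by (rule ext)
qed simp

lemma transport_mem_image_iff:
  assumes "bij_betw \<phi> X Y" "S \<subseteq> vectors_on X" "f \<in> vectors_on X"
  shows "transport X Y \<phi> f \<in> transport X Y \<phi> ` S \<longleftrightarrow> f \<in> S"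
  using transport_eq_iff[OF assms(1,3)] assms(2) by blast

lemma sum_transport:
  assumes "bij_betw \<phi> X Y"
  shows "(\<Sum>y\<in>Y. transport X Y \<phi> f y * transport X Y \<phi> g y) = (\<Sum>x\<in>X. f x * g x)"
  unfolding sum.reindex_bij_betw[OF assms, symmetric]
  by (rule sum.cong) (auto simp: transport_apply[OF assms])

lemma transport_transport:
  assumes "bij_betw \<phi> X Y" "bij_betw \<psi> Y Z"
    and "bij_betw \<chi> X Z" "\<And>x. x \<in> X \<Longrightarrow> \<psi> (\<phi> x) = \<chi> x"
  shows "transport Y Z \<psi> (transport X Y \<phi> f) = transport X Z \<chi> f"
proof (rule transport_unique[OF assms(2)])
  fix y assume "y \<in> Y"
  then obtain x where x: "x \<in> X" "y = \<phi> x" using assms(1) by (auto simp: bij_betw_def)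
  then show "transport X Z \<chi> f (\<psi> y) = transport X Y \<phi> f y"
    using assms by (simp add: transport_apply)
qed (rule transport_in_vectors_on)

lemma add_vectors_on_eq_iff:
  fixes f f' g g' :: "'e \<Rightarrow> 'f::field"
  assumes "X \<inter> Y = {}" "f \<in> vectors_on X" "f' \<in> vectors_on X" "g \<in> vectors_on Y" "g' \<in> vectors_on Y"
  shows "f + g = f' + g' \<longleftrightarrow> f = f' \<and> g = g'"
proof
  assume eq: "f + g = f' + g'"
  have pw: "f x + g x = f' x + g' x" for x using fun_cong[OF eq, of x] by simp
  have "f x = f' x" for x
    using pw[of x] assms by (cases "x \<in> X"; cases "x \<in> Y") (auto simp: vectors_on_def)
  then have "f = f'" by (rule ext)
  then show "f = f' \<and> g = g'" using eq by simp
qed simp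

text \<open>Pulling the second component back to \<open>X\<close> makes a space of vectors on \<open>X \<union> Y\<close> a linear
  relation between vectors on \<open>X\<close>; the two invariance conditions are statements about it.\<close>

lemma vectors_on_Un_cases:
  assumes "bij_betw \<phi> X Y" "h \<in> vectors_on (X \<union> Y)"
  obtains f g where "f \<in> vectors_on X" "g \<in> vectors_on X" "h = f + transport X Y \<phi> g"
proof -
  define f where "f = (\<lambda>x. if x \<in> X then h x else 0)"
  have "h - f \<in> vectors_on Y" "f \<in> vectors_on X"
    using assms(2) by (auto simp: vectors_on_def f_def)
  moreover from this obtain g where "g \<in> vectors_on X" "h - f = transport X Y \<phi> g"
    using transport_image_vectors_on[OF assms(1)] by blast
  ultimately show thesis using that by (metis add.commute diff_add_cancel)
qed

lemma ball_vectors_on_Un_iff: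
  assumes "bij_betw \<phi> X Y" "A \<subseteq> vectors_on (X \<union> Y)"
  shows "(\<forall>h\<in>A. Q h) \<longleftrightarrow> (\<forall>f\<in>vectors_on X. \<forall>g\<in>vectors_on X.
    f + transport X Y \<phi> g \<in> A \<longrightarrow> Q (f + transport X Y \<phi> g))" (is "_ \<longleftrightarrow> ?R")
proof
  assume R: ?R
  show "\<forall>h\<in>A. Q h"
  proof
    fix h assume h: "h \<in> A"
    then obtain f g where "f \<in> vectors_on X" "g \<in> vectors_on X" "h = f + transport X Y \<phi> g"
      using vectors_on_Un_cases[OF assms(1)] assms(2) by blast
    then show "Q h" using R h by blast
  qed
qed blast

lemma add_transport_in_vectors_on:
  assumes "f \<in> vectors_on X"
  shows "f + transport X Y \<phi> g \<in> vectors_on (X \<union> Y)"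
  using assms transport_in_vectors_on[of X Y \<phi> g] by (auto simp: vectors_on_def)

text \<open>A space supported on one of the two parts constrains only the component on that part; for the
  copy on \<open>Y\<close> the constraint can be read on \<open>X\<close> because transport preserves the dot product.\<close>

lemma orth_compl_Un_left:
  fixes S :: "('e \<Rightarrow> 'f::field) set"
  assumes "finite X" "X \<inter> Y = {}" "bij_betw \<phi> X Y" "S \<subseteq> vectors_on X"
    and "f \<in> vectors_on X"
  shows "f + transport X Y \<phi> g \<in> orth_compl (X \<union> Y) S \<longleftrightarrow> f \<in> orth_compl X S"
proof -
  have fin: "finite Y" using assms bij_betw_finite by blast
  have "(\<Sum>e\<in>X \<union> Y. (f + transport X Y \<phi> g) e * s e) = (\<Sum>e\<in>X. f e * s e)" if "s \<in> S" for s
  proof -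
    have s: "s \<in> vectors_on X" using that assms by blast
    have "(\<Sum>e\<in>X \<union> Y. (f + transport X Y \<phi> g) e * s e)
        = (\<Sum>e\<in>X. (f + transport X Y \<phi> g) e * s e)"
      using assms s fin by (intro sum.mono_neutral_right) (auto simp: vectors_on_def)
    also have "\<dots> = (\<Sum>e\<in>X. f e * s e)"
      using assms(2) by (intro sum.cong) (auto simp: transport_def)
    finally show ?thesis .
  qed
  then show ?thesis
    using assms(5) add_transport_in_vectors_on[OF assms(5)] by (auto simp: orth_compl_def)
qed

lemma orth_compl_Un_right:
  fixes S :: "('e \<Rightarrow> 'f::field) set"
  assumes "finite X" "X \<inter> Y = {}" "bij_betw \<phi> X Y" "S \<subseteq> vectors_on X"
    and "f \<in> vectors_on X" "g \<in> vectors_on X"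
  shows "f + transport X Y \<phi> g \<in> orth_compl (X \<union> Y) (transport X Y \<phi> ` S)
    \<longleftrightarrow> g \<in> orth_compl X S"
proof -
  have fin: "finite Y" using assms bij_betw_finite by blast
  have "(\<Sum>e\<in>X \<union> Y. (f + transport X Y \<phi> g) e * transport X Y \<phi> s e) = (\<Sum>e\<in>X. g e * s e)" for s
  proof -
    have "(\<Sum>e\<in>X \<union> Y. (f + transport X Y \<phi> g) e * transport X Y \<phi> s e)
        = (\<Sum>e\<in>Y. (f + transport X Y \<phi> g) e * transport X Y \<phi> s e)"
      using assms fin by (intro sum.mono_neutral_right) (auto simp: transport_def)
    also have "\<dots> = (\<Sum>e\<in>Y. transport X Y \<phi> g e * transport X Y \<phi> s e)"
      using assms(2,5) by (intro sum.cong) (auto simp: vectors_on_def)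
    also have "\<dots> = (\<Sum>e\<in>X. g e * s e)" by (rule sum_transport[OF assms(3)])
    finally show ?thesis .
  qed
  then show ?thesis
    using assms(6) add_transport_in_vectors_on[OF assms(5)] by (auto simp: orth_compl_def)
qed

section \<open>Invariance and the adjoint in terms of pairs\<close>

lemma conditioned_invariant_iff:
  fixes V S :: "('e \<Rightarrow> 'f::field) set"
  assumes "bij_betw d W Wd" "S \<subseteq> vectors_on W"
  shows "conditioned_invariant W Wd d V S \<longleftrightarrow>
    (\<forall>f\<in>S. \<forall>g\<in>vectors_on W. f + transport W Wd d g \<in> V \<longrightarrow> g \<in> S)"
proof -
  have "conditioned_invariant W Wd d V S \<longleftrightarrow>
    (\<forall>h\<in>vectors_on Wd. \<forall>f\<in>S. f + h \<in> V \<longrightarrow> h \<in> transport W Wd d ` S)"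
    by (auto simp: conditioned_invariant_def matched_comp_def add.commute)
  also have "\<dots> \<longleftrightarrow> (\<forall>g\<in>vectors_on W. \<forall>f\<in>S. f + transport W Wd d g \<in> V \<longrightarrow> g \<in> S)"
    unfolding transport_image_vectors_on[OF assms(1), symmetric]
    by (simp add: transport_mem_image_iff[OF assms])
  finally show ?thesis by blast
qed

lemma controlled_invariant_iff:
  assumes "S \<subseteq> vectors_on W"
  shows "controlled_invariant W Wd d V S \<longleftrightarrow> (\<forall>f\<in>S. \<exists>g\<in>S. f + transport W Wd d g \<in> V)"
  using assms by (auto simp: controlled_invariant_def matched_comp_def add.commute)

text \<open>Both components of a vector in the adjoint determine the pair that it comes from, because
  \<open>W'\<close> and its dotted copy are disjoint and transport is injective. As a relation on vectors on
  \<open>W\<close>, the adjoint is therefore the complement of \<open>V\<close> with its components swapped and one sign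
  changed.\<close>

lemma mem_adjoint_iff:
  fixes V :: "('e \<Rightarrow> 'f::field) set"
  assumes d: "bij_betw d W Wd" and p: "bij_betw p W W'" and d': "bij_betw d' W' Wd'"
    and disj: "W' \<inter> Wd' = {}"
    and ab: "a \<in> vectors_on W" "b \<in> vectors_on W"
  shows "transport W W' p a + transport W' Wd' d' (transport W W' p b)
      \<in> adjoint W Wd d W' Wd' d' p V \<longleftrightarrow>
    - b + transport W Wd d a \<in> orth_compl (W \<union> Wd) V"
    (is "?P a + ?D (?P b) \<in> _ \<longleftrightarrow> _")
proof -
  have dp: "bij_betw (d' \<circ> p) W Wd'" using p d' by (rule bij_betw_trans)
  have pd: "bij_betw (p \<circ> inv_into W d) Wd W'"
    using bij_betw_inv_into[OF d] p by (rule bij_betw_trans)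
  have 1: "transport Wd W' (p \<circ> inv_into W d) (transport W Wd d g) = ?P g" for g :: "'e \<Rightarrow> 'f"
    using d by (intro transport_transport[OF d pd p]) (auto simp: bij_betw_def)
  have 2: "- transport W Wd' (d' \<circ> p) f = ?D (?P (- f))" for f :: "'e \<Rightarrow> 'f"
    by (simp only: transport_transport[OF p d' dp] o_apply transport_uminus)
  have 3: "?P a + ?D (?P b) = ?P g + ?D (?P (- f)) \<longleftrightarrow> a = g \<and> b = - f"
    if "f \<in> vectors_on W" "g \<in> vectors_on W" for f g
  proof -
    have "- f \<in> vectors_on W" using that(1) vectors_on_uminus by blast
    then show ?thesis
      unfolding add_vectors_on_eq_iff[OF disj transport_in_vectors_on transport_in_vectors_on
          transport_in_vectors_on transport_in_vectors_on]
        transport_eq_iff[OF d' transport_in_vectors_on transport_in_vectors_on]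
      using transport_eq_iff[OF p ab(1) that(2)] transport_eq_iff[OF p ab(2)] by blast
  qed
  have "?P a + ?D (?P b) \<in> adjoint W Wd d W' Wd' d' p V \<longleftrightarrow>
    (\<exists>f\<in>vectors_on W. \<exists>g\<in>transport W Wd d ` vectors_on W.
      ?P a + ?D (?P b) = transport Wd W' (p \<circ> inv_into W d) g + ?D (?P (- f)) \<and>
      f + g \<in> orth_compl (W \<union> Wd) V)"
    unfolding adjoint_def 2 transport_image_vectors_on[OF d] by blast
  also have "\<dots> \<longleftrightarrow> (\<exists>f\<in>vectors_on W. \<exists>g\<in>vectors_on W.
      ?P a + ?D (?P b) = ?P g + ?D (?P (- f)) \<and>
      f + transport W Wd d g \<in> orth_compl (W \<union> Wd) V)"
    by (simp add: 1)
  also have "\<dots> \<longleftrightarrow> (\<exists>f\<in>vectors_on W. \<exists>g\<in>vectors_on W. a = g \<and> b = - f \<and>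
      f + transport W Wd d g \<in> orth_compl (W \<union> Wd) V)"
    using 3 by blast
  also have "\<dots> \<longleftrightarrow> - b + transport W Wd d a \<in> orth_compl (W \<union> Wd) V"
    using ab vectors_on_uminus by (metis minus_minus)
  finally show ?thesis .
qed

theorem theorem30:
  fixes W Wd W' Wd' :: "'e set"
    and d d' p :: "'e \<Rightarrow> 'e"
    and V VW :: "('e \<Rightarrow> 'f::field) set"
  assumes "genaut W Wd d V"
    and "vspace_on W VW"
    and "bij_betw p W W'"
    and "bij_betw d' W' Wd'"
    and "W' \<inter> Wd' = {}"
  shows "(conditioned_invariant W Wd d V VW \<longleftrightarrow>
            controlled_invariant W' Wd' d' (adjoint W Wd d W' Wd' d' p V)
              (transport W W' p ` orth_compl W VW)) \<and>
         (controlled_invariant W Wd d V VW \<longleftrightarrow>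
            conditioned_invariant W' Wd' d' (adjoint W Wd d W' Wd' d' p V)
              (transport W W' p ` orth_compl W VW))"
proof -
  have fin: "finite W" and disj: "W \<inter> Wd = {}" and d: "bij_betw d W Wd"
    and V: "fvec.subspace V" "V \<subseteq> vectors_on (W \<union> Wd)"
    using assms(1) by (auto simp: genaut_def vspace_on_def)
  have S: "fvec.subspace VW" "VW \<subseteq> vectors_on W"
    using assms(2) by (auto simp: vspace_on_def)
  note p = assms(3) and d' = assms(4)
  let ?X = "W \<union> Wd" and ?T = "transport W Wd d" and ?P = "transport W W' p"
  let ?D = "transport W' Wd' d'" and ?V' = "adjoint W Wd d W' Wd' d' p V"
  define K where "K = orth_compl W VW"
  have K: "fvec.subspace K" "K \<subseteq> vectors_on W"
    by (auto simp: K_def subspace_orth_compl orth_compl_subset[THEN subsetD])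
  have KK: "orth_compl W K = VW"
    unfolding K_def by (rule orth_compl_orth_compl[OF fin S])
  have finX: "finite ?X" using fin d bij_betw_finite by blast
  have PK: "?P ` K \<subseteq> vectors_on W'" by (auto simp: transport_in_vectors_on)
  have onX: "A \<subseteq> vectors_on ?X" "?T ` A \<subseteq> vectors_on ?X" if "A \<subseteq> vectors_on W" for A
    using that vectors_on_mono transport_in_vectors_on[of W Wd d] by blast+
  \<comment> \<open>The sign in the adjoint disappears because \<open>K\<close> is closed under negation.\<close>
  have neg_bex: "(\<exists>b\<in>K. - b + t \<in> A) \<longleftrightarrow> (\<exists>b\<in>K. t + b \<in> A)" for t A
    by (metis add.commute minus_minus subspace_uminus[OF K(1)])
  have neg_ball: "(\<forall>b\<in>vectors_on W. - b + t \<in> A \<longrightarrow> b \<in> K) \<longleftrightarrow>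
    (\<forall>f\<in>vectors_on W. f + t \<in> A \<longrightarrow> f \<in> K)" (is "?L \<longleftrightarrow> ?R") for t A
  proof
    assume L: ?L
    show ?R
    proof (intro ballI impI)
      fix f assume "f \<in> vectors_on W" "f + t \<in> A"
      then have "- f \<in> K" using L vectors_on_uminus[of f W] by (metis minus_minus)
      then show "f \<in> K" using subspace_uminus[OF K(1)] by blast
    qed
  next
    assume R: ?R
    show ?L using R vectors_on_uminus[of _ W] subspace_uminus[OF K(1)] by blast
  qed
  note adj = mem_adjoint_iff[OF d p d' assms(5), of _ _ V]
  have cond: "conditioned_invariant W Wd d V VW \<longleftrightarrow> controlled_invariant W' Wd' d' ?V' (?P ` K)"
  proof -
    have "controlled_invariant W' Wd' d' ?V' (?P ` K) \<longleftrightarrow>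
        (\<forall>a\<in>K. \<exists>b\<in>K. ?P a + ?D (?P b) \<in> ?V')"
      using controlled_invariant_iff[OF PK] by simp
    also have "\<dots> \<longleftrightarrow> (\<forall>a\<in>K. \<exists>b\<in>K. - b + ?T a \<in> orth_compl ?X V)"
      using adj K(2) by (meson subsetD)
    also have "\<dots> \<longleftrightarrow> (\<forall>c\<in>?T ` K. \<exists>b\<in>K. c + b \<in> orth_compl ?X V)"
      by (simp only: neg_bex ball_simps)
    also have "\<dots> \<longleftrightarrow> (\<forall>h\<in>orth_compl ?X (orth_compl ?X V).
        h \<in> orth_compl ?X K \<longrightarrow> h \<in> orth_compl ?X (?T ` K))"
      by (intro contained_in_sum_iff_orth_compl finX subspace_orth_compl orth_compl_subset K(1)
          onX K(2))
    also have "\<dots> \<longleftrightarrow> (\<forall>h\<in>V. h \<in> orth_compl ?X K \<longrightarrow> h \<in> orth_compl ?X (?T ` K))"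
      by (simp add: orth_compl_orth_compl[OF finX V])
    also have "\<dots> \<longleftrightarrow> (\<forall>f\<in>vectors_on W. \<forall>g\<in>vectors_on W. f + ?T g \<in> V \<longrightarrow>
        f + ?T g \<in> orth_compl ?X K \<longrightarrow> f + ?T g \<in> orth_compl ?X (?T ` K))"
      by (rule ball_vectors_on_Un_iff[OF d V(2)])
    also have "\<dots> \<longleftrightarrow> (\<forall>f\<in>vectors_on W. \<forall>g\<in>vectors_on W. f + ?T g \<in> V \<longrightarrow> f \<in> VW \<longrightarrow> g \<in> VW)"
      by (simp add: orth_compl_Un_left[OF fin disj d K(2)]
          orth_compl_Un_right[OF fin disj d K(2)] KK)
    also have "\<dots> \<longleftrightarrow> conditioned_invariant W Wd d V VW"
      using conditioned_invariant_iff[OF d S(2)] S(2) by blast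
    finally show ?thesis by blast
  qed
  have ctrl: "controlled_invariant W Wd d V VW \<longleftrightarrow> conditioned_invariant W' Wd' d' ?V' (?P ` K)"
  proof -
    have "controlled_invariant W Wd d V VW \<longleftrightarrow> (\<forall>c\<in>VW. \<exists>b\<in>?T ` VW. c + b \<in> V)"
      using controlled_invariant_iff[OF S(2)] by simp
    also have "\<dots> \<longleftrightarrow> (\<forall>h\<in>orth_compl ?X V.
        h \<in> orth_compl ?X (?T ` VW) \<longrightarrow> h \<in> orth_compl ?X VW)"
      by (intro contained_in_sum_iff_orth_compl finX V subspace_transport S(1) onX S(2))
    also have "\<dots> \<longleftrightarrow> (\<forall>f\<in>vectors_on W. \<forall>g\<in>vectors_on W. f + ?T g \<in> orth_compl ?X V \<longrightarrow>
        f + ?T g \<in> orth_compl ?X (?T ` VW) \<longrightarrow> f + ?T g \<in> orth_compl ?X VW)"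
      by (rule ball_vectors_on_Un_iff[OF d orth_compl_subset])
    also have "\<dots> \<longleftrightarrow> (\<forall>f\<in>vectors_on W. \<forall>g\<in>vectors_on W. f + ?T g \<in> orth_compl ?X V \<longrightarrow>
        g \<in> K \<longrightarrow> f \<in> K)"
      by (simp add: orth_compl_Un_left[OF fin disj d S(2)]
          orth_compl_Un_right[OF fin disj d S(2)] K_def)
    also have "\<dots> \<longleftrightarrow> (\<forall>a\<in>K. \<forall>b\<in>vectors_on W. - b + ?T a \<in> orth_compl ?X V \<longrightarrow> b \<in> K)"
      unfolding neg_ball using K(2) by blast
    also have "\<dots> \<longleftrightarrow> (\<forall>a\<in>K. \<forall>b\<in>vectors_on W. ?P a + ?D (?P b) \<in> ?V' \<longrightarrow> b \<in> K)"
      using adj K(2) by (meson subsetD)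
    also have "\<dots> \<longleftrightarrow> (\<forall>a\<in>?P ` K. \<forall>b\<in>?P ` vectors_on W. a + ?D b \<in> ?V' \<longrightarrow> b \<in> ?P ` K)"
      by (simp add: transport_mem_image_iff[OF p K(2)])
    also have "\<dots> \<longleftrightarrow> conditioned_invariant W' Wd' d' ?V' (?P ` K)"
      unfolding conditioned_invariant_iff[OF d' PK] transport_image_vectors_on[OF p] by blast
    finally show ?thesis .
  qed
  show ?thesis using cond ctrl unfolding K_def by blast
qed

end
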